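(* A finite diversity $(X,\delta)$ can be embedded in a Minkowski diversity with kernel equal to some parallelotope (that is, there are some $d$, a parallelotope $K \subseteq \mathbb{R}^d$ with non-empty interior and a map $\phi: X \to \mathbb{R}^d$ such that $\delta(A) = R(\phi(A),K)$ for all $A \subseteq X$) if and only if $(X,\delta)$ is a diameter diversity.
   Context: A convex body in $\mathbb{R}^d$ is a compact, convex set with non-empty interior. For a convex body $K$ in $\mathbb{R}^d$ (the kernel) and bounded $A \subseteq \mathbb{R}^d$, the generalized circumradius of $A$ with respect to $K$ is \[R(A,K) = \inf\{\lambda \ge 0 : A \subseteq \lambda K+x \mbox{ for some } x \in \mathbb{R}^d\}.\] A parallelotope in $\mathbb{R}^d$ is the image of a $d$-dimensional cube under a non-degenerate affine map. A diversity is a pair $(X,\delta)$ where $X$ is a set and $\delta$ is a function from the finite subsets of $X$ to $\mathbb{R}_{\geq 0}$ such that, for all finite $A,B,C \subseteq X$: (D1) $\delta(A)=0$ if and only if $|A| \leq 1$; (D2) if $B \neq \emptyset$ then $\delta(A \cup C) \leq \delta(A \cup B) + \delta(B \cup C)$. It is finite if $X$ is finite. A diversity $(X,\delta)$ is a diameter diversity if $\delta(A) = \max\{\delta(\{a,a'\}):a,a' \in A\}$ for all finite $A \subseteq X$ (with the maximum over the empty set taken to be $0$). The Minkowski diversity with kernel $K$ is $(\mathbb{R}^d,\delta_K)$ with $\delta_K(A) = R(A,K)$ for finite $A \subset \mathbb{R}^d$. *)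

theory Defs
  imports "HOL-Analysis.Analysis"
begin

(* The dimension d is quantified inside the statements using these definitions, so R^d is
   rendered as the topological space Euclidean_space d: functions nat => real vanishing at all
   indices >= d. Vector operations are written pointwise. *)

definition diversity :: "'a set \<Rightarrow> ('a set \<Rightarrow> real) \<Rightarrow> bool" where
  "diversity X \<delta> \<longleftrightarrow>
     (\<forall>A. finite A \<and> A \<subseteq> X \<longrightarrow> 0 \<le> \<delta> A) \<and>
     (\<forall>A. finite A \<and> A \<subseteq> X \<longrightarrow> (\<delta> A = 0 \<longleftrightarrow> card A \<le> 1)) \<and>
     (\<forall>A B C. finite A \<and> A \<subseteq> X \<and> finite B \<and> B \<subseteq> X \<and> finite C \<and> C \<subseteq> X \<and> B \<noteq> {} \<longrightarrow>
        \<delta> (A \<union> C) \<le> \<delta> (A \<union> B) + \<delta> (B \<union> C))"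

definition diameter_diversity :: "'a set \<Rightarrow> ('a set \<Rightarrow> real) \<Rightarrow> bool" where
  "diameter_diversity X \<delta> \<longleftrightarrow> diversity X \<delta> \<and>
     (\<forall>A. finite A \<and> A \<subseteq> X \<longrightarrow>
        \<delta> A = (if A = {} then 0 else Max {\<delta> {a, a'} | a a'. a \<in> A \<and> a' \<in> A}))"

(* Isometric embeddings; only the values on finite subsets of the carriers matter. *)
definition diversity_embedding ::
  "'a set \<Rightarrow> ('a set \<Rightarrow> real) \<Rightarrow> 'b set \<Rightarrow> ('b set \<Rightarrow> real) \<Rightarrow> ('a \<Rightarrow> 'b) \<Rightarrow> bool" where
  "diversity_embedding X \<delta> Y \<delta>' \<phi> \<longleftrightarrow>
     \<phi> ` X \<subseteq> Y \<and> (\<forall>A. finite A \<and> A \<subseteq> X \<longrightarrow> \<delta> A = \<delta>' (\<phi> ` A))"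

definition scaled_translate :: "real \<Rightarrow> (nat \<Rightarrow> real) set \<Rightarrow> (nat \<Rightarrow> real) \<Rightarrow> (nat \<Rightarrow> real) set" where
  "scaled_translate c K x = (\<lambda>k i. c * k i + x i) ` K"

(* Meaningful when K is a convex body in R^d and A is a bounded subset of R^d: then the infimum
   is over a nonempty set of nonnegative reals. *)
definition circumradius :: "nat \<Rightarrow> (nat \<Rightarrow> real) set \<Rightarrow> (nat \<Rightarrow> real) set \<Rightarrow> real" where
  "circumradius d A K =
     Inf {c. 0 \<le> c \<and> (\<exists>x \<in> topspace (Euclidean_space d). A \<subseteq> scaled_translate c K x)}"

definition minkowski_diversity :: "nat \<Rightarrow> (nat \<Rightarrow> real) set \<Rightarrow> (nat \<Rightarrow> real) set \<Rightarrow> real" where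
  "minkowski_diversity d K A = circumradius d A K"

definition affine_map_on :: "nat \<Rightarrow> ((nat \<Rightarrow> real) \<Rightarrow> (nat \<Rightarrow> real)) \<Rightarrow> bool" where
  "affine_map_on d f \<longleftrightarrow>
     f ` topspace (Euclidean_space d) \<subseteq> topspace (Euclidean_space d) \<and>
     (\<forall>x \<in> topspace (Euclidean_space d). \<forall>y \<in> topspace (Euclidean_space d). \<forall>t.
        f (\<lambda>i. (1 - t) * x i + t * y i) = (\<lambda>i. (1 - t) * f x i + t * f y i))"

definition unit_cube :: "nat \<Rightarrow> (nat \<Rightarrow> real) set" where
  "unit_cube d = {x \<in> topspace (Euclidean_space d). \<forall>i<d. 0 \<le> x i \<and> x i \<le> 1}"

(* Non-degenerate means invertible as a map of R^d. Using the unit cube loses no generality,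
   as all d-dimensional cubes are images of it under such maps. *)
definition parallelotope :: "nat \<Rightarrow> (nat \<Rightarrow> real) set \<Rightarrow> bool" where
  "parallelotope d K \<longleftrightarrow>
     (\<exists>f. affine_map_on d f \<and>
          bij_betw f (topspace (Euclidean_space d)) (topspace (Euclidean_space d)) \<and>
          K = f ` unit_cube d)"

end

theory Submission
  imports Defs
begin

text \<open>
  In the coordinates given by the edges of a parallelotope, the kernel is a cube, and a finite set
  fits into a translate of the cube scaled by \<open>c\<close> iff each of its coordinate projections has length
  at most \<open>c\<close>. This is a condition on pairs of points, so the circumradius is the largest
  circumradius of a pair. Conversely, a finite metric space embeds isometrically into
  \<open>\<ell>\<^sub>\<infinity>\<close> by recording the distances to all of its points (Frechet), and on sets with more
  than two points both diversities are determined by the pairs.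
\<close>

section \<open>Circumradius for a parallelotope, in edge coordinates\<close>

text \<open>Subtracting the image of the origin from \<open>f\<close> leaves a linear map. Only
  affine combinations of two points are available, so \<open>c * u + v\<close> is taken as the
  midpoint of \<open>2 * c * u\<close> and \<open>2 * v\<close>, and these are reached on lines
  through the origin.\<close>

lemma affine_map_on_combination:
  assumes f: "affine_map_on d f"
    and u: "u \<in> topspace (Euclidean_space d)" and v: "v \<in> topspace (Euclidean_space d)"
  shows "f (\<lambda>i. c * u i + v i) = (\<lambda>i. c * (f u i - f (\<lambda>_. 0) i) + f v i)"
proof -
  have aff: "f (\<lambda>i. (1 - t) * x i + t * y i) = (\<lambda>i. (1 - t) * f x i + t * f y i)"
    if "x \<in> topspace (Euclidean_space d)" "y \<in> topspace (Euclidean_space d)" for x y t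
    using f that by (auto simp: affine_map_on_def)
  have scale: "f (\<lambda>i. t * x i) = (\<lambda>i. (1 - t) * f (\<lambda>_. 0) i + t * f x i)"
    if "x \<in> topspace (Euclidean_space d)" for x t
    using aff[of "\<lambda>_. 0" x t] that by (simp add: topspace_Euclidean_space)
  have "f (\<lambda>i. (1 - 1/2) * (2 * c * u i) + 1/2 * (2 * v i))
      = (\<lambda>i. (1 - 1/2) * f (\<lambda>i. 2 * c * u i) i + 1/2 * f (\<lambda>i. 2 * v i) i)"
    using u v by (intro aff) (auto simp: topspace_Euclidean_space)
  then show ?thesis
    unfolding scale[OF u] scale[OF v] by (simp add: algebra_simps diff_divide_distrib add_divide_distrib)
qed

text \<open>By \<open>fg\<close> and \<open>gf\<close>, \<open>g\<close> inverts the linear part of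
  \<open>f\<close>. It therefore turns scaled translates of the kernel into scaled translates of the
  unit cube, where containment can be tested one coordinate at a time.\<close>

lemma subset_scaled_translate_iff:
  assumes f: "affine_map_on d f"
    and g_in: "\<And>a. a \<in> topspace (Euclidean_space d) \<Longrightarrow> g a \<in> topspace (Euclidean_space d)"
    and fg: "\<And>a. a \<in> topspace (Euclidean_space d) \<Longrightarrow> f (g a) = (\<lambda>i. a i + f (\<lambda>_. 0) i)"
    and gf: "\<And>x. x \<in> topspace (Euclidean_space d) \<Longrightarrow> g (\<lambda>i. f x i - f (\<lambda>_. 0) i) = x"
    and A: "finite A" "A \<subseteq> topspace (Euclidean_space d)" and "0 \<le> c"
  shows "(\<exists>x \<in> topspace (Euclidean_space d). A \<subseteq> scaled_translate c (f ` unit_cube d) x)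
    \<longleftrightarrow> (\<forall>i<d. \<forall>a\<in>A. \<forall>b\<in>A. g a i - g b i \<le> c)"
proof
  let ?E = "topspace (Euclidean_space d)"
  have f_in: "f x \<in> ?E" if "x \<in> ?E" for x
    using f that by (auto simp: affine_map_on_def)
  have zero: "(\<lambda>_. 0) \<in> ?E"
    by (simp add: topspace_Euclidean_space)
  {
    assume "\<exists>x \<in> ?E. A \<subseteq> scaled_translate c (f ` unit_cube d) x"
    then obtain x where x: "x \<in> ?E" and sub: "A \<subseteq> scaled_translate c (f ` unit_cube d) x"
      by blast
    \<comment> \<open>The kernel is the linear image of the cube shifted by the image of the origin;
      scaling multiplies this shift by \<open>c\<close>. Hence \<open>p\<close> is the corner of the
      scaled cube in edge coordinates.\<close>
    define p where "p = g (\<lambda>i. x i + c * f (\<lambda>_. 0) i)"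
    have xc: "(\<lambda>i. x i + c * f (\<lambda>_. 0) i) \<in> ?E"
      using x f_in[OF zero] by (simp add: topspace_Euclidean_space)
    have p: "p \<in> ?E"
      unfolding p_def using xc by (rule g_in)
    have coord: "\<exists>u\<in>unit_cube d. \<forall>i. g a i = c * u i + p i" if a_in: "a \<in> A" for a
    proof -
      obtain u where u: "u \<in> unit_cube d" and a: "a = (\<lambda>i. c * f u i + x i)"
        using sub a_in unfolding scaled_translate_def by blast
      have uE: "u \<in> ?E" using u by (simp add: unit_cube_def)
      have "(\<lambda>i. f (\<lambda>i. c * u i + p i) i - f (\<lambda>_. 0) i) = a"
        unfolding affine_map_on_combination[OF f uE p] a
        by (simp add: p_def fg[OF xc] algebra_simps)
      moreover have "(\<lambda>i. c * u i + p i) \<in> ?E"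
        using uE p by (simp add: topspace_Euclidean_space)
      ultimately have "g a = (\<lambda>i. c * u i + p i)"
        using gf by metis
      with u show ?thesis by auto
    qed
    show "\<forall>i<d. \<forall>a\<in>A. \<forall>b\<in>A. g a i - g b i \<le> c"
    proof (intro allI impI ballI)
      fix i a b assume i: "i < d" and "a \<in> A" "b \<in> A"
      then obtain u v where uv: "u \<in> unit_cube d" "v \<in> unit_cube d"
        and "g a i = c * u i + p i" "g b i = c * v i + p i"
        using coord by meson
      then have "g a i - g b i = c * (u i - v i)"
        by (simp add: algebra_simps)
      moreover have "u i \<le> 1" "0 \<le> v i"
        using uv i by (auto simp: unit_cube_def)
      ultimately show "g a i - g b i \<le> c"
        using mult_left_mono[of "u i - v i" 1 c] \<open>0 \<le> c\<close> by simp
    qed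
  }
  {
    assume close: "\<forall>i<d. \<forall>a\<in>A. \<forall>b\<in>A. g a i - g b i \<le> c"
    define y where "y = (\<lambda>i. if i < d then Min ((\<lambda>a. g a i) ` A) else 0)"
    define x where "x = (\<lambda>i. f y i - f (\<lambda>_. 0) i - c * f (\<lambda>_. 0) i)"
    have y: "y \<in> ?E"
      by (simp add: y_def topspace_Euclidean_space)
    have x: "x \<in> ?E"
      using f_in[OF y] f_in[OF zero] by (simp add: x_def topspace_Euclidean_space)
    have "a \<in> scaled_translate c (f ` unit_cube d) x" if a: "a \<in> A" for a
    proof -
      \<comment> \<open>For \<open>c = 0\<close> the division yields the origin, which still lies in
        the cube; the bounds then force \<open>g a = y\<close>, so \<open>c * u + y\<close> is
        \<open>g a\<close> in this case too.\<close>
      define u where "u = (\<lambda>i. (g a i - y i) / c)"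
      have ga: "g a \<in> ?E" using g_in A a by blast
      have bounds: "0 \<le> g a i - y i \<and> g a i - y i \<le> c" if i: "i < d" for i
      proof -
        have "Min ((\<lambda>a. g a i) ` A) \<in> (\<lambda>a. g a i) ` A"
          using A a by (intro Min_in) auto
        then obtain b where "b \<in> A" "y i = g b i"
          using i by (auto simp: y_def)
        moreover have "y i \<le> g a i"
          using A a i by (simp add: y_def)
        ultimately show ?thesis using close i a by auto
      qed
      have uE: "u \<in> ?E"
        using ga y by (simp add: u_def topspace_Euclidean_space)
      have u: "u \<in> unit_cube d"
        using uE bounds \<open>0 \<le> c\<close> by (auto simp: unit_cube_def u_def divide_le_eq_1)
      have "c * u i + y i = g a i" for i
      proof (cases "c = 0")
        case True
        have "g a i = y i"
        proof (cases "i < d")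
          case True then show ?thesis using bounds[of i] \<open>c = 0\<close> by auto
        next
          case False then show ?thesis using ga y by (simp add: topspace_Euclidean_space)
        qed
        with True show ?thesis by simp
      qed (simp add: u_def)
      then have "f (g a) = (\<lambda>i. c * (f u i - f (\<lambda>_. 0) i) + f y i)"
        using affine_map_on_combination[OF f uE y, of c] by simp
      then have "a i = c * f u i + x i" for i
        using fg[of a] A a by (auto simp: fun_eq_iff x_def algebra_simps dest!: spec[of _ i])
      then have "a = (\<lambda>i. c * f u i + x i)" by (rule ext)
      with u show ?thesis
        unfolding scaled_translate_def by blast
    qed
    with x show "\<exists>x \<in> ?E. A \<subseteq> scaled_translate c (f ` unit_cube d) x"
      by blast
  }
qed

text \<open>\<open>S\<close> is an intersection of closed half-lines, nonempty and bounded below, so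
  it contains its infimum. This makes the infimum usable through its upper bounds alone.\<close>

lemma Inf_coordinate_widths:
  fixes g :: "'b \<Rightarrow> nat \<Rightarrow> real" and d :: nat
  assumes "finite A"
  defines "S \<equiv> {c. 0 \<le> c \<and> (\<forall>i<d. \<forall>a\<in>A. \<forall>b\<in>A. g a i - g b i \<le> c)}"
  shows "0 \<le> Inf S"
    and "0 \<le> c \<Longrightarrow> Inf S \<le> c \<longleftrightarrow> (\<forall>i<d. \<forall>a\<in>A. \<forall>b\<in>A. g a i - g b i \<le> c)"
proof -
  have S_eq: "S = {0..} \<inter> (\<Inter>i\<in>{..<d}. \<Inter>a\<in>A. \<Inter>b\<in>A. {g a i - g b i..})"
    by (auto simp: S_def)
  have closed: "closed S"
    unfolding S_eq by (intro closed_Int closed_INT ballI closed_atLeast)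
  \<comment> \<open>The added 0 makes the maximum nonnegative and defined even if \<open>A\<close>
    is empty or \<open>d = 0\<close>.\<close>
  let ?W = "insert 0 ((\<lambda>(i, a, b). g a i - g b i) ` ({..<d} \<times> A \<times> A))"
  have "finite ?W" using assms(1) by simp
  then have "Max ?W \<in> S"
    unfolding S_def by (auto intro!: Max_ge image_eqI[where x = "(_, _, _)"])
  then have ne: "S \<noteq> {}" by blast
  have bdd: "bdd_below S"
    by (rule bdd_belowI[of _ 0]) (simp add: S_def)
  have Inf_in: "Inf S \<in> S"
    by (rule closed_contains_Inf[OF ne bdd closed])
  then show "0 \<le> Inf S" by (simp add: S_def)
  show "Inf S \<le> c \<longleftrightarrow> (\<forall>i<d. \<forall>a\<in>A. \<forall>b\<in>A. g a i - g b i \<le> c)" if "0 \<le> c"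
  proof
    assume "Inf S \<le> c"
    with Inf_in show "\<forall>i<d. \<forall>a\<in>A. \<forall>b\<in>A. g a i - g b i \<le> c"
      unfolding S_def by (auto intro: order_trans)
  next
    assume "\<forall>i<d. \<forall>a\<in>A. \<forall>b\<in>A. g a i - g b i \<le> c"
    with that show "Inf S \<le> c"
      by (intro cInf_lower bdd) (simp add: S_def)
  qed
qed

text \<open>The restriction to \<open>0 \<le> c\<close> matters for empty \<open>A\<close>: the
  condition on the right is then vacuous, while the circumradius is 0.\<close>

lemma circumradius_le_iff:
  assumes f: "affine_map_on d f"
    and g_in: "\<And>a. a \<in> topspace (Euclidean_space d) \<Longrightarrow> g a \<in> topspace (Euclidean_space d)"
    and fg: "\<And>a. a \<in> topspace (Euclidean_space d) \<Longrightarrow> f (g a) = (\<lambda>i. a i + f (\<lambda>_. 0) i)"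
    and gf: "\<And>x. x \<in> topspace (Euclidean_space d) \<Longrightarrow> g (\<lambda>i. f x i - f (\<lambda>_. 0) i) = x"
    and A: "finite A" "A \<subseteq> topspace (Euclidean_space d)"
  shows "0 \<le> circumradius d A (f ` unit_cube d)"
    and "0 \<le> c \<Longrightarrow> circumradius d A (f ` unit_cube d) \<le> c
      \<longleftrightarrow> (\<forall>i<d. \<forall>a\<in>A. \<forall>b\<in>A. g a i - g b i \<le> c)"
proof -
  have eq: "circumradius d A (f ` unit_cube d)
      = Inf {c. 0 \<le> c \<and> (\<forall>i<d. \<forall>a\<in>A. \<forall>b\<in>A. g a i - g b i \<le> c)}"
    unfolding circumradius_def
    using subset_scaled_translate_iff[OF assms] by (intro arg_cong[of _ _ Inf]) blast
  show "0 \<le> circumradius d A (f ` unit_cube d)"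
    unfolding eq by (rule Inf_coordinate_widths(1)[OF A(1)])
  show "0 \<le> c \<Longrightarrow> circumradius d A (f ` unit_cube d) \<le> c
      \<longleftrightarrow> (\<forall>i<d. \<forall>a\<in>A. \<forall>b\<in>A. g a i - g b i \<le> c)"
    unfolding eq by (rule Inf_coordinate_widths(2)[OF A(1)])
qed

lemma parallelotope_circumradius_le_iff:
  assumes "parallelotope d K"
  obtains g :: "(nat \<Rightarrow> real) \<Rightarrow> nat \<Rightarrow> real"
  where "\<And>A c. \<lbrakk>finite A; A \<subseteq> topspace (Euclidean_space d); 0 \<le> c\<rbrakk> \<Longrightarrow>
      circumradius d A K \<le> c \<longleftrightarrow> (\<forall>i<d. \<forall>a\<in>A. \<forall>b\<in>A. g a i - g b i \<le> c)"
proof -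
  let ?E = "topspace (Euclidean_space d)"
  obtain f where f: "affine_map_on d f" and bij: "bij_betw f ?E ?E" and K: "K = f ` unit_cube d"
    using assms by (auto simp: parallelotope_def)
  \<comment> \<open>Adding the image of the origin before inverting \<open>f\<close> gives the
    inverse of its linear part.\<close>
  define g where "g a = inv_into ?E f (\<lambda>i. a i + f (\<lambda>_. 0) i)" for a
  have "f (\<lambda>_. 0) \<in> ?E"
    using bij by (auto simp: bij_betw_def topspace_Euclidean_space)
  then have shift: "(\<lambda>i. a i + f (\<lambda>_. 0) i) \<in> f ` ?E" if "a \<in> ?E" for a
    using bij that by (simp add: bij_betw_def topspace_Euclidean_space)
  have "g a \<in> ?E" "f (g a) = (\<lambda>i. a i + f (\<lambda>_. 0) i)" if "a \<in> ?E" for a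
    unfolding g_def using shift[OF that] by (rule inv_into_into, rule f_inv_into_f)
  moreover have "g (\<lambda>i. f x i - f (\<lambda>_. 0) i) = x" if "x \<in> ?E" for x
    using bij that by (simp add: g_def bij_betw_def inv_into_f_f)
  ultimately show ?thesis
    using that[of g] circumradius_le_iff(2)[OF f, of g] K by blast
qed

section \<open>The unit cube as kernel\<close>

lemma affine_map_on_id: "affine_map_on d (\<lambda>x. x)"
  by (auto simp: affine_map_on_def)

lemma parallelotope_unit_cube: "parallelotope d (unit_cube d)"
  unfolding parallelotope_def
  by (rule exI[of _ "\<lambda>x. x"]) (simp add: affine_map_on_id bij_betw_def)

lemma circumradius_unit_cube:
  assumes "finite A" "A \<subseteq> topspace (Euclidean_space d)"
  shows "0 \<le> circumradius d A (unit_cube d)"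
    and "0 \<le> c \<Longrightarrow> circumradius d A (unit_cube d) \<le> c
      \<longleftrightarrow> (\<forall>i<d. \<forall>a\<in>A. \<forall>b\<in>A. a i - b i \<le> c)"
  using circumradius_le_iff(1)[OF affine_map_on_id, of d "\<lambda>x. x" A]
    circumradius_le_iff(2)[OF affine_map_on_id, of d "\<lambda>x. x" A c] assms by auto

lemma interior_of_unit_cube_nonempty: "Euclidean_space d interior_of unit_cube d \<noteq> {}"
proof -
  \<comment> \<open>Only finitely many factors are proper subsets, so the box is open in the product
    topology; its trace on the space is the open cube, with centre \<open>?c\<close>.\<close>
  let ?U = "\<lambda>i. if i < d then {0<..<1::real} else UNIV"
  let ?c = "\<lambda>i. if i < d then 1/2 else 0 :: real"
  have "openin (powertop_real UNIV) (Pi\<^sub>E UNIV ?U)"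
    by (rule product_topology_basis) (auto intro: finite_subset[of _ "{..<d}"])
  then have "openin (Euclidean_space d) (Pi\<^sub>E UNIV ?U \<inter> topspace (Euclidean_space d))"
    by (auto simp: Euclidean_space_def openin_subtopology)
  moreover have "Pi\<^sub>E UNIV ?U \<inter> topspace (Euclidean_space d) \<subseteq> unit_cube d"
    by (force simp: unit_cube_def PiE_iff split: if_splits)
  moreover have "?c \<in> Pi\<^sub>E UNIV ?U \<inter> topspace (Euclidean_space d)"
    by (simp add: PiE_iff topspace_Euclidean_space)
  ultimately show ?thesis
    unfolding interior_of_def by blast
qed

section \<open>Diversities determined by their pairs\<close>

text \<open>A nonnegative number is determined by its nonnegative upper bounds: \<open>le\<close> is
  used once with the maximum as \<open>c\<close> and once with \<open>\<delta> A\<close>. The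
  singletons ensure that the maximum is nonnegative.\<close>

lemma eq_Max_pairs:
  fixes \<delta> :: "'a set \<Rightarrow> real"
  assumes "finite A" "A \<noteq> {}" "0 \<le> \<delta> A" "\<And>a. a \<in> A \<Longrightarrow> 0 \<le> \<delta> {a}"
    and le: "\<And>c. 0 \<le> c \<Longrightarrow> \<delta> A \<le> c \<longleftrightarrow> (\<forall>a\<in>A. \<forall>b\<in>A. \<delta> {a, b} \<le> c)"
  shows "\<delta> A = Max {\<delta> {a, a'} | a a'. a \<in> A \<and> a' \<in> A}"
proof -
  let ?D = "{\<delta> {a, a'} | a a'. a \<in> A \<and> a' \<in> A}"
  have "?D = (\<lambda>(a, b). \<delta> {a, b}) ` (A \<times> A)" by auto
  then have fin: "finite ?D" using assms(1) by simp
  obtain a where a: "a \<in> A" using assms(2) by blast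
  then have "\<delta> {a, a} \<in> ?D" by blast
  then have "0 \<le> Max ?D"
    using Max_ge[OF fin] assms(4)[OF a] by fastforce
  moreover have "\<delta> {a, b} \<le> Max ?D" if "a \<in> A" "b \<in> A" for a b
    using that by (intro Max_ge[OF fin]) blast
  ultimately have "\<delta> A \<le> Max ?D" using le by blast
  moreover have "Max ?D \<le> \<delta> A"
    using le[OF assms(3)] a by (subst Max_le_iff[OF fin]) auto
  ultimately show ?thesis by simp
qed

text \<open>Converse passage, from the maximum back to upper bounds. It includes the empty set,
  whose value is 0 by convention.\<close>

lemma diameter_diversity_le_iff:
  assumes "diameter_diversity X \<delta>" "finite A" "A \<subseteq> X" "0 \<le> c"
  shows "\<delta> A \<le> c \<longleftrightarrow> (\<forall>a\<in>A. \<forall>b\<in>A. \<delta> {a, b} \<le> c)"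
proof (cases "A = {}")
  case True
  then show ?thesis using assms by (auto simp: diameter_diversity_def)
next
  case False
  let ?D = "{\<delta> {a, a'} | a a'. a \<in> A \<and> a' \<in> A}"
  have "?D = (\<lambda>(a, b). \<delta> {a, b}) ` (A \<times> A)" by auto
  then have "finite ?D" "?D \<noteq> {}" using assms(2) False by simp_all
  moreover have "\<delta> A = Max ?D"
    using assms False by (auto simp: diameter_diversity_def)
  ultimately show ?thesis by (auto simp: Max_le_iff)
qed

section \<open>The two implications\<close>

text \<open>The width condition on \<open>A\<close> involves two points at a time and uses one
  \<open>g\<close> for all sets, so it holds for \<open>A\<close> exactly when it holds for every
  pair from \<open>A\<close>.\<close>

lemma parallelotope_embedding_imp_diameter_diversity:
  assumes "diversity X \<delta>" "parallelotope d K"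
    and emb: "diversity_embedding X \<delta> (topspace (Euclidean_space d)) (minkowski_diversity d K) \<phi>"
  shows "diameter_diversity X \<delta>"
proof -
  obtain g :: "(nat \<Rightarrow> real) \<Rightarrow> nat \<Rightarrow> real"
    where g: "\<And>A c. \<lbrakk>finite A; A \<subseteq> topspace (Euclidean_space d); 0 \<le> c\<rbrakk> \<Longrightarrow>
      circumradius d A K \<le> c \<longleftrightarrow> (\<forall>i<d. \<forall>a\<in>A. \<forall>b\<in>A. g a i - g b i \<le> c)"
    using parallelotope_circumradius_le_iff[OF assms(2)] by blast
  have \<phi>: "\<phi> ` X \<subseteq> topspace (Euclidean_space d)"
    and \<delta>: "\<And>A. \<lbrakk>finite A; A \<subseteq> X\<rbrakk> \<Longrightarrow> \<delta> A = circumradius d (\<phi> ` A) K"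
    using emb by (auto simp: diversity_embedding_def minkowski_diversity_def)
  have nonneg: "0 \<le> \<delta> A" if "finite A" "A \<subseteq> X" for A
    using assms(1) that by (simp add: diversity_def)
  have le: "\<delta> A \<le> c \<longleftrightarrow> (\<forall>i<d. \<forall>a\<in>A. \<forall>b\<in>A. g (\<phi> a) i - g (\<phi> b) i \<le> c)"
    if "finite A" "A \<subseteq> X" "0 \<le> c" for A c
    using \<delta>[OF that(1,2)] g[of "\<phi> ` A" c] \<phi> that by fastforce
  have "\<delta> A = Max {\<delta> {a, a'} | a a'. a \<in> A \<and> a' \<in> A}"
    if A: "finite A" "A \<subseteq> X" "A \<noteq> {}" for A
  proof (rule eq_Max_pairs)
    fix c :: real assume c: "0 \<le> c"
    have "\<delta> {a, b} \<le> c \<longleftrightarrow> (\<forall>i<d. \<forall>x\<in>{a, b}. \<forall>y\<in>{a, b}. g (\<phi> x) i - g (\<phi> y) i \<le> c)"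
      if "a \<in> A" "b \<in> A" for a b
      using le[of "{a, b}" c] that A c by auto
    then show "\<delta> A \<le> c \<longleftrightarrow> (\<forall>a\<in>A. \<forall>b\<in>A. \<delta> {a, b} \<le> c)"
      using le[OF A(1,2) c] c by auto
  qed (use A nonneg in auto)
  moreover have "\<delta> {} = 0"
    using assms(1) by (auto simp: diversity_def)
  ultimately show ?thesis
    using assms(1) by (auto simp: diameter_diversity_def)
qed

text \<open>For the unit cube, edge coordinates are the given ones. It is enough to reproduce the
  values on pairs as sup distances, since these fix the values on larger sets on both sides.\<close>

lemma diameter_diversity_imp_unit_cube_embedding:
  assumes "finite X" "diameter_diversity X \<delta>"
  obtains d \<phi> where "1 \<le> d"
    and "diversity_embedding X \<delta> (topspace (Euclidean_space d))
           (minkowski_diversity d (unit_cube d)) \<phi>"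
proof -
  have div: "diversity X \<delta>" using assms(2) by (simp add: diameter_diversity_def)
  obtain e where e: "bij_betw e {..<card X} X"
    using ex_bij_betw_nat_finite[OF assms(1)] by (auto simp: atLeast0LessThan)
  \<comment> \<open>The extra coordinate keeps the dimension positive when \<open>X\<close> is empty.\<close>
  define d where "d = Suc (card X)"
  define \<phi> where "\<phi> a i = (if i < card X then \<delta> {a, e i} else 0)" for a i
  have \<phi>_in: "\<phi> ` X \<subseteq> topspace (Euclidean_space d)"
    by (auto simp: \<phi>_def d_def topspace_Euclidean_space)
  have nonneg: "0 \<le> \<delta> A" if "finite A" "A \<subseteq> X" for A
    using div that by (simp add: diversity_def)
  \<comment> \<open>This is (D2) for three singletons.\<close>
  have triangle: "\<delta> {a, x} \<le> \<delta> {a, b} + \<delta> {b, x}" if "a \<in> X" "b \<in> X" "x \<in> X" for a b x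
    using div[unfolded diversity_def, THEN conjunct2, THEN conjunct2, rule_format,
      of "{a}" "{b}" "{x}"] that by (simp add: insert_commute)
  \<comment> \<open>The coordinate indexed by \<open>b\<close> attains the distance, because
    \<open>\<delta> {b} = 0\<close>; the triangle inequality bounds the other distance coordinates,
    and the extra one contributes 0.\<close>
  have pair: "(\<forall>i<d. \<phi> a i - \<phi> b i \<le> c) \<longleftrightarrow> \<delta> {a, b} \<le> c"
    if ab: "a \<in> X" "b \<in> X" and c: "0 \<le> c" for a b c
  proof
    obtain j where j: "j < card X" "e j = b"
      using e ab by (force simp: bij_betw_def)
    assume "\<forall>i<d. \<phi> a i - \<phi> b i \<le> c"
    then have "\<phi> a j - \<phi> b j \<le> c" using j by (simp add: d_def)
    moreover have "\<delta> {b} = 0" using div ab by (auto simp: diversity_def)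
    ultimately show "\<delta> {a, b} \<le> c" using j by (simp add: \<phi>_def)
  next
    assume le: "\<delta> {a, b} \<le> c"
    show "\<forall>i<d. \<phi> a i - \<phi> b i \<le> c"
    proof (intro allI impI)
      fix i
      show "\<phi> a i - \<phi> b i \<le> c"
      proof (cases "i < card X")
        case True
        then have "e i \<in> X" using e by (auto simp: bij_betw_def)
        then show ?thesis using triangle[of a b "e i"] ab le True by (simp add: \<phi>_def)
      qed (use c in \<open>simp add: \<phi>_def\<close>)
    qed
  qed
  have "\<delta> A = circumradius d (\<phi> ` A) (unit_cube d)" if A: "finite A" "A \<subseteq> X" for A
  proof -
    have fin: "finite (\<phi> ` A)" "\<phi> ` A \<subseteq> topspace (Euclidean_space d)"
      using A \<phi>_in by auto
    have "circumradius d (\<phi> ` A) (unit_cube d) \<le> c \<longleftrightarrow> \<delta> A \<le> c" if c: "0 \<le> c" for c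
    proof -
      have "circumradius d (\<phi> ` A) (unit_cube d) \<le> c
          \<longleftrightarrow> (\<forall>a\<in>A. \<forall>b\<in>A. \<forall>i<d. \<phi> a i - \<phi> b i \<le> c)"
        using circumradius_unit_cube(2)[OF fin c] by auto
      also have "\<dots> \<longleftrightarrow> (\<forall>a\<in>A. \<forall>b\<in>A. \<delta> {a, b} \<le> c)"
        using pair A c by (meson subsetD)
      also have "\<dots> \<longleftrightarrow> \<delta> A \<le> c"
        using diameter_diversity_le_iff[OF assms(2) A c] by simp
      finally show ?thesis .
    qed
    \<comment> \<open>Taking \<open>c\<close> to be each of the two values in turn gives both
      inequalities.\<close>
    from this[OF nonneg[OF A]] this[OF circumradius_unit_cube(1)[OF fin]]
    show ?thesis by simp
  qed
  then have "diversity_embedding X \<delta> (topspace (Euclidean_space d))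
      (minkowski_diversity d (unit_cube d)) \<phi>"
    using \<phi>_in by (simp add: diversity_embedding_def minkowski_diversity_def)
  moreover have "1 \<le> d" by (simp add: d_def)
  ultimately show ?thesis using that by blast
qed

theorem theorem16:
  fixes X :: "'a set" and \<delta> :: "'a set \<Rightarrow> real"
  assumes "finite X" and "diversity X \<delta>"
  shows "(\<exists>d K \<phi>. 1 \<le> d \<and> parallelotope d K \<and> Euclidean_space d interior_of K \<noteq> {} \<and>
            diversity_embedding X \<delta> (topspace (Euclidean_space d)) (minkowski_diversity d K) \<phi>)
         \<longleftrightarrow> diameter_diversity X \<delta>"
  using parallelotope_embedding_imp_diameter_diversity[OF assms(2)]
    diameter_diversity_imp_unit_cube_embedding[OF assms(1)]
    parallelotope_unit_cube interior_of_unit_cube_nonempty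
  by metis

end
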